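(* Let $G$ be a finite group, let $u\in Z(G)$ with $u^2=1$, and equip $\Bbbk G$ with the $R$-matrix $R_u=\frac12(1\otimes1+1\otimes u+u\otimes1-u\otimes u)$. Let $L$ be a subgroup of $G$. Then the $K$-matrices of the left coideal subalgebra $\Bbbk L$ of $\Bbbk G$ are exactly the elements $K=a\otimes1$, where $a\in C_G(L)$, the centralizer of $L$ in $G$.
   Context: $\Bbbk$ is an algebraically closed field of characteristic zero, $\otimes=\otimes_\Bbbk$; $\Bbbk G$ has its usual Hopf structure, $\Delta(g)=g\otimes g$. For a quasitriangular Hopf algebra $(H,R)$ and a left coideal subalgebra $B\subseteq H$ (a subalgebra with $\Delta(B)\subseteq H\otimes B$), with $\delta=\Delta|_B$, a $K$-matrix of $B$ is an invertible element $K\in H\otimes B$ such that $(\Delta\otimes\mathrm{id}_B)(K)=K_{23}R_{21}K_{13}R_{21}^{-1}$, $(\mathrm{id}_H\otimes\delta)(K)=R_{21}K_{13}R_{12}$, and $K\delta(b)=\delta(b)K$ for all $b\in B$. *)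

theory Defs
  imports
    "HOL-Library.Poly_Mapping"
    "HOL-Computational_Algebra.Polynomial"
    "HOL-Algebra.Coset"
begin

text \<open>
  Every vector space has a basis, so an algebra (Hopf algebra) over a field \<open>'k\<close> is given here by
  a basis \<open>I\<close>, a set of elements of a type \<open>'b\<close>, and by the values of the structure maps on basis
  elements. Its elements are the finitely supported functions \<^typ>\<open>'b \<Rightarrow>\<^sub>0 'k\<close> with support in
  \<open>I\<close>. The tensor product of the spaces with bases \<open>I\<close> and \<open>J\<close> is then the space with basis
  \<open>I \<times> J\<close>, where the pair \<open>(a, b)\<close> stands for the tensor of \<open>a\<close> and \<open>b\<close>.
\<close>

section \<open>Free vector spaces and their tensor products\<close>

definition scale :: "'k::field \<Rightarrow> ('b \<Rightarrow>\<^sub>0 'k) \<Rightarrow> ('b \<Rightarrow>\<^sub>0 'k)" where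
  "scale c x = Poly_Mapping.map ((*) c) x"

lemma lookup_scale [simp]:
  "Poly_Mapping.lookup (scale c x) b = c * Poly_Mapping.lookup x b"
  by (simp add: scale_def Poly_Mapping.map.rep_eq when_def)

global_interpretation free_vs: vector_space "scale :: 'k::field \<Rightarrow> ('b \<Rightarrow>\<^sub>0 'k) \<Rightarrow> _"
  by unfold_locales (auto intro!: poly_mapping_eqI simp: lookup_add algebra_simps)

abbreviation basis_vec :: "'b \<Rightarrow> ('b \<Rightarrow>\<^sub>0 'k::field)" where
  "basis_vec b \<equiv> Poly_Mapping.single b 1"

definition free_space :: "'b set \<Rightarrow> ('b \<Rightarrow>\<^sub>0 'k::field) set" where
  "free_space I = {x. Poly_Mapping.keys x \<subseteq> I}"

text \<open>The linear map with prescribed values on the basis.\<close>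

definition lin_ext :: "('a \<Rightarrow> ('b \<Rightarrow>\<^sub>0 'k::field)) \<Rightarrow> ('a \<Rightarrow>\<^sub>0 'k) \<Rightarrow> ('b \<Rightarrow>\<^sub>0 'k)" where
  "lin_ext f x = (\<Sum>a\<in>Poly_Mapping.keys x. scale (Poly_Mapping.lookup x a) (f a))"

definition tensor :: "('a \<Rightarrow>\<^sub>0 'k::field) \<Rightarrow> ('b \<Rightarrow>\<^sub>0 'k) \<Rightarrow> ('a \<times> 'b \<Rightarrow>\<^sub>0 'k)" where
  "tensor x y = lin_ext (\<lambda>a. lin_ext (\<lambda>b. basis_vec (a, b)) y) x"

text \<open>For subspaces \<open>U\<close>, \<open>V\<close> this is the image of their tensor product in that of the
  ambient spaces; over a field the map between the two tensor products is injective.\<close>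

definition tensor_space ::
    "('a \<Rightarrow>\<^sub>0 'k::field) set \<Rightarrow> ('b \<Rightarrow>\<^sub>0 'k) set \<Rightarrow> ('a \<times> 'b \<Rightarrow>\<^sub>0 'k) set" where
  "tensor_space U V = free_vs.span {tensor x y | x y. x \<in> U \<and> y \<in> V}"

definition tensor_map ::
    "(('a \<Rightarrow>\<^sub>0 'k::field) \<Rightarrow> ('c \<Rightarrow>\<^sub>0 'k)) \<Rightarrow> (('b \<Rightarrow>\<^sub>0 'k) \<Rightarrow> ('d \<Rightarrow>\<^sub>0 'k)) \<Rightarrow>
      ('a \<times> 'b \<Rightarrow>\<^sub>0 'k) \<Rightarrow> ('c \<times> 'd \<Rightarrow>\<^sub>0 'k)" where
  "tensor_map f g = lin_ext (\<lambda>(a, b). tensor (f (basis_vec a)) (g (basis_vec b)))"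

definition tensor_flip :: "('a \<times> 'b \<Rightarrow>\<^sub>0 'k::field) \<Rightarrow> ('b \<times> 'a \<Rightarrow>\<^sub>0 'k)" where
  "tensor_flip = lin_ext (\<lambda>(a, b). basis_vec (b, a))"

definition tensor_assoc :: "(('a \<times> 'b) \<times> 'c \<Rightarrow>\<^sub>0 'k::field) \<Rightarrow> ('a \<times> 'b \<times> 'c \<Rightarrow>\<^sub>0 'k)" where
  "tensor_assoc = lin_ext (\<lambda>((a, b), c). basis_vec (a, b, c))"


section \<open>Algebras\<close>

record (overloaded) ('b, 'k) based_algebra =
  basis :: "'b set"
  basis_mult :: "'b \<Rightarrow> 'b \<Rightarrow> ('b \<Rightarrow>\<^sub>0 'k::field)"
  alg_one :: "'b \<Rightarrow>\<^sub>0 'k"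

definition alg_space :: "('b, 'k::field, 'm) based_algebra_scheme \<Rightarrow> ('b \<Rightarrow>\<^sub>0 'k) set" where
  "alg_space A = free_space (basis A)"

definition alg_mult ::
    "('b, 'k::field, 'm) based_algebra_scheme \<Rightarrow> ('b \<Rightarrow>\<^sub>0 'k) \<Rightarrow> ('b \<Rightarrow>\<^sub>0 'k) \<Rightarrow> ('b \<Rightarrow>\<^sub>0 'k)" where
  "alg_mult A x y = lin_ext (\<lambda>a. lin_ext (\<lambda>b. basis_mult A a b) y) x"

definition alg_inverse_of ::
    "('b, 'k::field, 'm) based_algebra_scheme \<Rightarrow> ('b \<Rightarrow>\<^sub>0 'k) \<Rightarrow> ('b \<Rightarrow>\<^sub>0 'k) \<Rightarrow> bool" where
  "alg_inverse_of A x y \<longleftrightarrow> alg_mult A x y = alg_one A \<and> alg_mult A y x = alg_one A"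

definition alg_inv ::
    "('b, 'k::field, 'm) based_algebra_scheme \<Rightarrow> ('b \<Rightarrow>\<^sub>0 'k) \<Rightarrow> ('b \<Rightarrow>\<^sub>0 'k)" where
  "alg_inv A x = (THE y. y \<in> alg_space A \<and> alg_inverse_of A x y)"

text \<open>By multilinearity it is enough to state the axioms, here and for Hopf algebras below, on
  basis elements.\<close>

locale assoc_algebra =
  fixes A :: "('b, 'k::field, 'm) based_algebra_scheme"
  assumes one_closed: "alg_one A \<in> alg_space A"
    and mult_closed: "\<lbrakk>a \<in> basis A; b \<in> basis A\<rbrakk> \<Longrightarrow> basis_mult A a b \<in> alg_space A"
    and mult_assoc: "\<lbrakk>a \<in> basis A; b \<in> basis A; c \<in> basis A\<rbrakk> \<Longrightarrow>
      alg_mult A (basis_mult A a b) (basis_vec c) = alg_mult A (basis_vec a) (basis_mult A b c)"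
    and one_left: "a \<in> basis A \<Longrightarrow> alg_mult A (alg_one A) (basis_vec a) = basis_vec a"
    and one_right: "a \<in> basis A \<Longrightarrow> alg_mult A (basis_vec a) (alg_one A) = basis_vec a"

definition tensor_algebra ::
    "('a, 'k::field, 'm) based_algebra_scheme \<Rightarrow> ('b, 'k, 'n) based_algebra_scheme \<Rightarrow>
      ('a \<times> 'b, 'k) based_algebra" where
  "tensor_algebra A B =
    \<lparr>basis = basis A \<times> basis B,
     basis_mult = (\<lambda>(a, b) (a', b'). tensor (basis_mult A a a') (basis_mult B b b')),
     alg_one = tensor (alg_one A) (alg_one B)\<rparr>"

abbreviation tensor2 ::
    "('b, 'k::field, 'm) based_algebra_scheme \<Rightarrow> ('b \<times> 'b, 'k) based_algebra" where
  "tensor2 H \<equiv> tensor_algebra H H"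

abbreviation tensor3 ::
    "('b, 'k::field, 'm) based_algebra_scheme \<Rightarrow> ('b \<times> 'b \<times> 'b, 'k) based_algebra" where
  "tensor3 H \<equiv> tensor_algebra H (tensor_algebra H H)"

text \<open>The leg embeddings of the two-fold into the three-fold tensor power.\<close>

definition leg12 ::
    "('b, 'k::field, 'm) based_algebra_scheme \<Rightarrow> ('b \<times> 'b \<Rightarrow>\<^sub>0 'k) \<Rightarrow> ('b \<times> 'b \<times> 'b \<Rightarrow>\<^sub>0 'k)" where
  "leg12 H x = tensor_assoc (tensor x (alg_one H))"

definition leg23 ::
    "('b, 'k::field, 'm) based_algebra_scheme \<Rightarrow> ('b \<times> 'b \<Rightarrow>\<^sub>0 'k) \<Rightarrow> ('b \<times> 'b \<times> 'b \<Rightarrow>\<^sub>0 'k)" where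
  "leg23 H x = tensor (alg_one H) x"

definition leg13 ::
    "('b, 'k::field, 'm) based_algebra_scheme \<Rightarrow> ('b \<times> 'b \<Rightarrow>\<^sub>0 'k) \<Rightarrow> ('b \<times> 'b \<times> 'b \<Rightarrow>\<^sub>0 'k)" where
  "leg13 H = lin_ext (\<lambda>(a, b). tensor (basis_vec a) (tensor (alg_one H) (basis_vec b)))"

definition leg21 ::
    "('b, 'k::field, 'm) based_algebra_scheme \<Rightarrow> ('b \<times> 'b \<Rightarrow>\<^sub>0 'k) \<Rightarrow> ('b \<times> 'b \<times> 'b \<Rightarrow>\<^sub>0 'k)" where
  "leg21 H x = leg12 H (tensor_flip x)"


section \<open>Quasitriangular Hopf algebras\<close>

record (overloaded) ('b, 'k) based_hopf = "('b, 'k::field) based_algebra" +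
  basis_comult :: "'b \<Rightarrow> ('b \<times> 'b \<Rightarrow>\<^sub>0 'k)"
  basis_counit :: "'b \<Rightarrow> 'k"
  basis_antipode :: "'b \<Rightarrow> ('b \<Rightarrow>\<^sub>0 'k)"

definition comult ::
    "('b, 'k::field, 'm) based_hopf_scheme \<Rightarrow> ('b \<Rightarrow>\<^sub>0 'k) \<Rightarrow> ('b \<times> 'b \<Rightarrow>\<^sub>0 'k)" where
  "comult H = lin_ext (basis_comult H)"

definition counit :: "('b, 'k::field, 'm) based_hopf_scheme \<Rightarrow> ('b \<Rightarrow>\<^sub>0 'k) \<Rightarrow> 'k" where
  "counit H x = (\<Sum>a\<in>Poly_Mapping.keys x. Poly_Mapping.lookup x a * basis_counit H a)"

definition antipode ::
    "('b, 'k::field, 'm) based_hopf_scheme \<Rightarrow> ('b \<Rightarrow>\<^sub>0 'k) \<Rightarrow> ('b \<Rightarrow>\<^sub>0 'k)" where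
  "antipode H = lin_ext (basis_antipode H)"

definition comult_id ::
    "('b, 'k::field, 'm) based_hopf_scheme \<Rightarrow> ('b \<times> 'b \<Rightarrow>\<^sub>0 'k) \<Rightarrow> ('b \<times> 'b \<times> 'b \<Rightarrow>\<^sub>0 'k)" where
  "comult_id H x = tensor_assoc (tensor_map (comult H) id x)"

definition id_comult ::
    "('b, 'k::field, 'm) based_hopf_scheme \<Rightarrow> ('b \<times> 'b \<Rightarrow>\<^sub>0 'k) \<Rightarrow> ('b \<times> 'b \<times> 'b \<Rightarrow>\<^sub>0 'k)" where
  "id_comult H x = tensor_map id (comult H) x"

definition alg_fold ::
    "('b, 'k::field, 'm) based_algebra_scheme \<Rightarrow> ('b \<times> 'b \<Rightarrow>\<^sub>0 'k) \<Rightarrow> ('b \<Rightarrow>\<^sub>0 'k)" where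
  "alg_fold A = lin_ext (\<lambda>(a, b). basis_mult A a b)"

locale hopf_algebra = assoc_algebra H
  for H :: "('b, 'k::field, 'm) based_hopf_scheme" +
  assumes comult_closed: "a \<in> basis H \<Longrightarrow> basis_comult H a \<in> alg_space (tensor2 H)"
    and coassoc: "a \<in> basis H \<Longrightarrow>
      comult_id H (basis_comult H a) = id_comult H (basis_comult H a)"
    and counit_left: "a \<in> basis H \<Longrightarrow>
      lin_ext (\<lambda>(b, c). scale (basis_counit H b) (basis_vec c)) (basis_comult H a) = basis_vec a"
    and counit_right: "a \<in> basis H \<Longrightarrow>
      lin_ext (\<lambda>(b, c). scale (basis_counit H c) (basis_vec b)) (basis_comult H a) = basis_vec a"
    and comult_one: "comult H (alg_one H) = alg_one (tensor2 H)"
    and comult_mult: "\<lbrakk>a \<in> basis H; b \<in> basis H\<rbrakk> \<Longrightarrow>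
      comult H (basis_mult H a b) = alg_mult (tensor2 H) (basis_comult H a) (basis_comult H b)"
    and counit_one: "counit H (alg_one H) = 1"
    and counit_mult: "\<lbrakk>a \<in> basis H; b \<in> basis H\<rbrakk> \<Longrightarrow>
      counit H (basis_mult H a b) = basis_counit H a * basis_counit H b"
    and antipode_closed: "a \<in> basis H \<Longrightarrow> basis_antipode H a \<in> alg_space H"
    and antipode_left: "a \<in> basis H \<Longrightarrow>
      alg_fold H (tensor_map (antipode H) id (basis_comult H a)) =
        scale (basis_counit H a) (alg_one H)"
    and antipode_right: "a \<in> basis H \<Longrightarrow>
      alg_fold H (tensor_map id (antipode H) (basis_comult H a)) =
        scale (basis_counit H a) (alg_one H)"

locale quasitriangular_hopf_algebra = hopf_algebra H
  for H :: "('b, 'k::field, 'm) based_hopf_scheme" +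
  fixes R :: "'b \<times> 'b \<Rightarrow>\<^sub>0 'k"
  assumes R_closed: "R \<in> alg_space (tensor2 H)"
    and R_invertible: "\<exists>R' \<in> alg_space (tensor2 H). alg_inverse_of (tensor2 H) R R'"
    and R_comult: "a \<in> basis H \<Longrightarrow>
      alg_mult (tensor2 H) R (basis_comult H a) =
        alg_mult (tensor2 H) (tensor_flip (basis_comult H a)) R"
    and comult_id_R: "comult_id H R = alg_mult (tensor3 H) (leg13 H R) (leg23 H R)"
    and id_comult_R: "id_comult H R = alg_mult (tensor3 H) (leg13 H R) (leg12 H R)"


section \<open>Left coideal subalgebras and \<open>K\<close>-matrices\<close>

locale left_coideal_subalgebra = hopf_algebra H
  for H :: "('b, 'k::field, 'm) based_hopf_scheme" +
  fixes B :: "('b \<Rightarrow>\<^sub>0 'k) set"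
  assumes sub_space: "free_vs.subspace B" "B \<subseteq> alg_space H"
    and sub_one: "alg_one H \<in> B"
    and sub_mult: "\<lbrakk>x \<in> B; y \<in> B\<rbrakk> \<Longrightarrow> alg_mult H x y \<in> B"
    and sub_coideal: "x \<in> B \<Longrightarrow> comult H x \<in> tensor_space (alg_space H) B"

text \<open>Meant for \<open>(H, R)\<close> quasitriangular and \<open>B\<close> a left coideal subalgebra of \<open>H\<close>. Since
  \<open>B \<subseteq> H\<close>, all equations are written in the tensor powers of \<open>H\<close>; the inverse of \<open>K\<close>
  is required to lie in the tensor product of \<open>H\<close> and \<open>B\<close> as well.\<close>

definition K_matrix ::
    "('b, 'k::field, 'm) based_hopf_scheme \<Rightarrow> ('b \<times> 'b \<Rightarrow>\<^sub>0 'k) \<Rightarrow> ('b \<Rightarrow>\<^sub>0 'k) set \<Rightarrow>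
      ('b \<times> 'b \<Rightarrow>\<^sub>0 'k) \<Rightarrow> bool" where
  "K_matrix H R B K \<longleftrightarrow>
     K \<in> tensor_space (alg_space H) B \<and>
     (\<exists>K' \<in> tensor_space (alg_space H) B. alg_inverse_of (tensor2 H) K K') \<and>
     (let m3 = alg_mult (tensor3 H) in
       comult_id H K =
         m3 (m3 (m3 (leg23 H K) (leg21 H R)) (leg13 H K)) (alg_inv (tensor3 H) (leg21 H R)) \<and>
       id_comult H K = m3 (m3 (leg21 H R) (leg13 H K)) (leg12 H R)) \<and>
     (\<forall>b \<in> B. alg_mult (tensor2 H) K (comult H b) = alg_mult (tensor2 H) (comult H b) K)"


section \<open>Group algebras\<close>

definition centralizer :: "('g, 'm) monoid_scheme \<Rightarrow> 'g set \<Rightarrow> 'g set" where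
  "centralizer G L = {a \<in> carrier G. \<forall>l \<in> L. a \<otimes>\<^bsub>G\<^esub> l = l \<otimes>\<^bsub>G\<^esub> a}"

definition group_center :: "('g, 'm) monoid_scheme \<Rightarrow> 'g set" where
  "group_center G = centralizer G (carrier G)"

definition group_hopf :: "('g, 'm) monoid_scheme \<Rightarrow> ('g, 'k::field) based_hopf" where
  "group_hopf G =
    \<lparr>basis = carrier G,
     basis_mult = (\<lambda>a b. basis_vec (a \<otimes>\<^bsub>G\<^esub> b)),
     alg_one = basis_vec \<one>\<^bsub>G\<^esub>,
     basis_comult = (\<lambda>a. tensor (basis_vec a) (basis_vec a)),
     basis_counit = (\<lambda>a. 1),
     basis_antipode = (\<lambda>a. basis_vec (inv\<^bsub>G\<^esub> a))\<rparr>"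

definition group_R :: "('g, 'm) monoid_scheme \<Rightarrow> 'g \<Rightarrow> ('g \<times> 'g \<Rightarrow>\<^sub>0 'k::field)" where
  "group_R G u =
    (let e = basis_vec \<one>\<^bsub>G\<^esub>; v = basis_vec u in
     scale (1 / 2) (tensor e e + tensor e v + tensor v e - tensor v v))"

text \<open>For a subgroup \<open>L\<close> of \<open>G\<close>, the group algebra of \<open>L\<close> as a subset of that of \<open>G\<close> is
  \<^term>\<open>free_space L\<close>.\<close>

text \<open>The data above satisfy the axioms of the structures they are meant to carry.\<close>

lemma lin_ext_single [simp]: "lin_ext f (Poly_Mapping.single a c) = scale c (f a)"
  by (cases "c = 0") (simp_all add: lin_ext_def)

lemma lin_ext_superset:
  assumes "finite S" "Poly_Mapping.keys x \<subseteq> S"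
  shows "lin_ext f x = (\<Sum>a\<in>S. scale (Poly_Mapping.lookup x a) (f a))"
  unfolding lin_ext_def
  by (rule sum.mono_neutral_left) (use assms in \<open>auto simp: in_keys_iff\<close>)

lemma lin_ext_add: "lin_ext f (x + y) = lin_ext f x + lin_ext f y"
proof -
  let ?S = "Poly_Mapping.keys x \<union> Poly_Mapping.keys y"
  have "lin_ext f z = (\<Sum>a\<in>?S. scale (Poly_Mapping.lookup z a) (f a))"
    if "Poly_Mapping.keys z \<subseteq> ?S" for z
    using that by (intro lin_ext_superset) auto
  then show ?thesis
    using Poly_Mapping.keys_add[of x y]
    by (simp add: lookup_add free_vs.scale_left_distrib sum.distrib)
qed

lemma lin_ext_scale: "lin_ext f (scale c x) = scale c (lin_ext f x)"
proof -
  have "lin_ext f (scale c x) =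
      (\<Sum>a\<in>Poly_Mapping.keys x. scale (Poly_Mapping.lookup (scale c x) a) (f a))"
    by (intro lin_ext_superset) (auto simp: in_keys_iff)
  then show ?thesis
    by (simp add: lin_ext_def free_vs.scale_sum_right)
qed

lemma lin_ext_diff: "lin_ext f (x - y) = lin_ext f x - lin_ext f y"
  using lin_ext_add[of f "x - y" y] by simp

lemma lin_ext_add_fun: "lin_ext (\<lambda>a. f a + g a) x = lin_ext f x + lin_ext g x"
  by (simp add: lin_ext_def free_vs.scale_right_distrib sum.distrib)

lemma lin_ext_diff_fun: "lin_ext (\<lambda>a. f a - g a) x = lin_ext f x - lin_ext g x"
  by (simp add: lin_ext_def free_vs.scale_right_diff_distrib sum_subtractf)

lemma lin_ext_scale_fun: "lin_ext (\<lambda>a. scale c (f a)) x = scale c (lin_ext f x)"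
  by (simp add: lin_ext_def free_vs.scale_sum_right mult.commute)

lemmas lin_simps = lin_ext_add lin_ext_scale lin_ext_diff
  lin_ext_add_fun lin_ext_diff_fun lin_ext_scale_fun
  tensor_def tensor_map_def tensor_flip_def tensor_assoc_def alg_mult_def tensor_algebra_def
  leg12_def leg13_def leg23_def leg21_def comult_def antipode_def comult_id_def id_comult_def
  alg_fold_def alg_space_def free_space_def counit_def

lemma hopf_algebra_group_hopf:
  assumes "group G"
  shows "hopf_algebra (group_hopf G :: ('g, 'k::field) based_hopf)"
proof -
  interpret group G by fact
  show ?thesis
    by unfold_locales (simp_all add: group_hopf_def lin_simps m_assoc)
qed

lemma group_R_expand:
  "group_R G u = scale (1 / 2) (basis_vec (\<one>\<^bsub>G\<^esub>, \<one>\<^bsub>G\<^esub>) + basis_vec (\<one>\<^bsub>G\<^esub>, u)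
     + basis_vec (u, \<one>\<^bsub>G\<^esub>) - basis_vec (u, u))"
  by (simp add: group_R_def lin_simps)

lemma quasitriangular_group_hopf:
  assumes "group G" and u: "u \<in> group_center G" and uu: "u \<otimes>\<^bsub>G\<^esub> u = \<one>\<^bsub>G\<^esub>"
  shows "quasitriangular_hopf_algebra (group_hopf G)
           (group_R G u :: 'g \<times> 'g \<Rightarrow>\<^sub>0 'k::field_char_0)"
proof -
  interpret group G by fact
  interpret hopf_algebra "group_hopf G :: ('g, 'k) based_hopf"
    using hopf_algebra_group_hopf[OF assms(1)] .
  have comm: "u \<otimes>\<^bsub>G\<^esub> a = a \<otimes>\<^bsub>G\<^esub> u" if "a \<in> carrier G" for a
    using u that by (auto simp: group_center_def centralizer_def)
  have uc: "u \<in> carrier G"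
    using u by (auto simp: group_center_def centralizer_def)
  let ?H = "group_hopf G :: ('g, 'k) based_hopf"
  let ?R = "group_R G u :: 'g \<times> 'g \<Rightarrow>\<^sub>0 'k"
  show ?thesis
  proof unfold_locales
    show closed: "?R \<in> alg_space (tensor2 ?H)"
      using uc by (auto simp: group_R_expand alg_space_def free_space_def tensor_algebra_def
          group_hopf_def in_keys_iff lookup_add lookup_minus lookup_single when_def split: if_splits)
    have "alg_inverse_of (tensor2 ?H) ?R ?R"
      unfolding alg_inverse_of_def group_R_expand
      by (intro conjI poly_mapping_eqI;
          simp add: lin_simps group_hopf_def uc uu lookup_add lookup_minus field_simps)
    then show "\<exists>R' \<in> alg_space (tensor2 ?H). alg_inverse_of (tensor2 ?H) ?R R'"
      using closed by blast
    show "alg_mult (tensor2 ?H) ?R (basis_comult ?H a) =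
        alg_mult (tensor2 ?H) (tensor_flip (basis_comult ?H a)) ?R"
      if "a \<in> basis ?H" for a
      using that unfolding group_R_expand
      by (simp add: lin_simps group_hopf_def uc comm)
    show "comult_id ?H ?R = alg_mult (tensor3 ?H) (leg13 ?H ?R) (leg23 ?H ?R)"
      unfolding group_R_expand
      by (rule poly_mapping_eqI)
        (simp add: lin_simps group_hopf_def uc uu lookup_add lookup_minus field_simps)
    show "id_comult ?H ?R = alg_mult (tensor3 ?H) (leg13 ?H ?R) (leg12 ?H ?R)"
      unfolding group_R_expand
      by (rule poly_mapping_eqI)
        (simp add: lin_simps group_hopf_def uc uu lookup_add lookup_minus field_simps)
  qed
qed

lemma subspace_free_space: "free_vs.subspace (free_space I :: ('b \<Rightarrow>\<^sub>0 'k::field) set)"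
proof (rule free_vs.subspaceI)
  show "x + y \<in> free_space I" if "x \<in> free_space I" "y \<in> free_space I" for x y :: "'b \<Rightarrow>\<^sub>0 'k"
    using that Poly_Mapping.keys_add[of x y] unfolding free_space_def by blast
qed (auto simp: free_space_def in_keys_iff)

lemma left_coideal_subalgebra_group_hopf:
  assumes "group G" and "subgroup L G"
  shows "left_coideal_subalgebra (group_hopf G) (free_space L :: ('g \<Rightarrow>\<^sub>0 'k::field) set)"
proof -
  interpret group G by fact
  interpret hopf_algebra "group_hopf G :: ('g, 'k) based_hopf"
    using hopf_algebra_group_hopf[OF assms(1)] .
  let ?H = "group_hopf G :: ('g, 'k) based_hopf"
  have LG: "l \<in> carrier G" if "l \<in> L" for l
    using subgroup.subset[OF assms(2)] that by blast
  show ?thesis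
  proof unfold_locales
    show "free_vs.subspace (free_space L :: ('g \<Rightarrow>\<^sub>0 'k) set)"
      by (rule subspace_free_space)
    show "free_space L \<subseteq> alg_space ?H"
      using LG by (auto simp: alg_space_def free_space_def group_hopf_def)
    show "alg_one ?H \<in> free_space L"
      using subgroup.one_closed[OF assms(2)] by (simp add: free_space_def group_hopf_def)
    fix x y :: "'g \<Rightarrow>\<^sub>0 'k"
    assume x: "x \<in> free_space L"
    show "alg_mult ?H x y \<in> free_space L" if y: "y \<in> free_space L"
      unfolding alg_mult_def lin_ext_def
    proof (intro free_vs.subspace_sum free_vs.subspace_scale subspace_free_space)
      fix a b assume "a \<in> Poly_Mapping.keys x" "b \<in> Poly_Mapping.keys y"
      then have "a \<in> L" "b \<in> L" using x y by (auto simp: free_space_def)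
      then show "basis_mult ?H a b \<in> free_space L"
        using subgroup.m_closed[OF assms(2)] by (simp add: free_space_def group_hopf_def)
    qed
    show "comult ?H x \<in> tensor_space (alg_space ?H) (free_space L)"
      unfolding comult_def lin_ext_def tensor_space_def
    proof (intro free_vs.span_sum free_vs.span_scale)
      fix a assume "a \<in> Poly_Mapping.keys x"
      then have "a \<in> L" using x by (auto simp: free_space_def)
      then have "basis_vec a \<in> alg_space ?H" "basis_vec a \<in> (free_space L :: ('g \<Rightarrow>\<^sub>0 'k) set)"
        using LG by (auto simp: free_space_def alg_space_def group_hopf_def)
      then show "basis_comult ?H a \<in>
          free_vs.span {tensor x y |x y. x \<in> alg_space ?H \<and> y \<in> free_space L}"
        by (intro free_vs.span_base) (auto simp: group_hopf_def)
    qed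
  qed
qed

end

theory Submission
  imports Defs
begin

text \<open>
  The element \<open>R = R\<^sub>u\<close> is central, symmetric and satisfies \<open>R\<^sup>2 = 1\<close>, so it drops out of
  both coproduct equations, which become \<open>(\<Delta> \<otimes> id)(K) = K\<^sub>2\<^sub>3 K\<^sub>1\<^sub>3\<close> and
  \<open>(id \<otimes> \<delta>)(K) = K\<^sub>1\<^sub>3\<close>. Comparing coefficients, the second one forces \<open>K = x \<otimes> 1\<close>;
  the first one then says that \<open>x\<close> is group-like, hence an element of the group, since \<open>x\<close> is
  nonzero. Commutation with \<open>\<delta>(l) = l \<otimes> l\<close> means that \<open>x\<close> centralizes \<open>L\<close>.
\<close>

section \<open>Linear induction and supports in free vector spaces\<close>

text \<open>Multilinear identities are reduced with this rule to basis vectors, one argument at a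
  time. The case \<open>zero\<close> covers the empty linear combination, the only one when
  \<open>I\<close> is empty.\<close>

lemma free_space_induct [consumes 1, case_names basis add scale zero]:
  fixes x :: "'b \<Rightarrow>\<^sub>0 'k::field"
  assumes x: "x \<in> free_space I"
    and basis: "\<And>a. a \<in> I \<Longrightarrow> P (basis_vec a)"
    and add: "\<And>x y. \<lbrakk>x \<in> free_space I; y \<in> free_space I; P x; P y\<rbrakk> \<Longrightarrow> P (x + y)"
    and scale: "\<And>c x. \<lbrakk>x \<in> free_space I; P x\<rbrakk> \<Longrightarrow> P (scale c x)"
    and zero: "P 0"
  shows "P x"
proof -
  \<comment> \<open>Induct on a finite set containing the support; cancellation may then shrink the
    support freely.\<close>
  have "finite A \<Longrightarrow> A \<subseteq> I \<Longrightarrow> Poly_Mapping.keys y \<subseteq> A \<Longrightarrow> P y" for A and y :: "'b \<Rightarrow>\<^sub>0 'k"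
  proof (induction A arbitrary: y rule: finite_induct)
    case empty
    then show ?case using zero by simp
  next
    case (insert a A)
    define c where "c = Poly_Mapping.lookup y a"
    define z where "z = y - scale c (basis_vec a)"
    have keys: "Poly_Mapping.keys z \<subseteq> A"
    proof
      fix b assume "b \<in> Poly_Mapping.keys z"
      then have "b \<noteq> a" "b \<in> Poly_Mapping.keys y"
        by (auto simp: z_def c_def in_keys_iff lookup_minus lookup_single when_def split: if_splits)
      then show "b \<in> A" using insert.prems by auto
    qed
    have "P z" using insert.IH keys insert.prems by auto
    moreover have "P (scale c (basis_vec a))"
      using insert.prems by (intro scale basis) (auto simp: free_space_def)
    moreover have "z \<in> free_space I" "scale c (basis_vec a) \<in> free_space I"
      using keys insert.prems subspace_free_space[of I, THEN free_vs.subspace_scale, of "basis_vec a" c]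
      by (auto simp: free_space_def)
    ultimately have "P (z + scale c (basis_vec a))" by (intro add)
    then show ?case by (simp add: z_def)
  qed
  from this[of "Poly_Mapping.keys x" x] x show ?thesis by (simp add: free_space_def)
qed

lemma tensor_basis_vec [simp]: "tensor (basis_vec a) (basis_vec b) = basis_vec (a, b)"
  by (simp add: tensor_def)

lemma lin_ext_zero [simp]: "lin_ext f 0 = 0"
  by (simp add: lin_ext_def)

lemma lin_ext_zero_fun [simp]: "lin_ext (\<lambda>_. 0) x = 0"
  by (simp add: lin_ext_def)

lemma lookup_tensor:
  "Poly_Mapping.lookup (tensor x y) (a, b) = Poly_Mapping.lookup x a * Poly_Mapping.lookup y b"
proof -
  have y: "y \<in> free_space UNIV" by (simp add: free_space_def)
  have "x \<in> free_space UNIV" by (simp add: free_space_def)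
  then show ?thesis
  proof (induction rule: free_space_induct)
    case (basis c)
    from y show ?case
      by (induction rule: free_space_induct)
        (auto simp: tensor_def lin_simps lookup_add lookup_single algebra_simps when_def)
  qed (simp_all add: lin_simps lookup_add algebra_simps)
qed

text \<open>Turns membership in a span into a condition on the support, which is what a comparison
  of coefficients can use.\<close>

lemma tensor_space_subset_free_space:
  fixes I :: "'a set" and J :: "'b set"
  shows "tensor_space (free_space I) (free_space J) \<subseteq>
    (free_space (I \<times> J) :: ('a \<times> 'b \<Rightarrow>\<^sub>0 'k::field) set)"
  unfolding tensor_space_def
proof (rule free_vs.span_minimal[OF _ subspace_free_space], safe)
  fix x :: "'a \<Rightarrow>\<^sub>0 'k" and y :: "'b \<Rightarrow>\<^sub>0 'k"
  assume "x \<in> free_space I" "y \<in> free_space J"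
  then show "tensor x y \<in> free_space (I \<times> J)"
    by (force simp: free_space_def in_keys_iff lookup_tensor)
qed

text \<open>Tensoring with a fixed vector is linear, so the tensors of this form already make up a
  subspace. It is applied with \<open>e = \<one>\<close> once the second leg of \<open>K\<close> is
  known to be trivial.\<close>

lemma free_space_Times_singleton:
  assumes "K \<in> free_space (I \<times> {e})"
  obtains x where "x \<in> free_space I" "K = tensor x (basis_vec e)"
proof -
  from assms have "\<exists>x\<in>free_space I. K = tensor x (basis_vec e)"
  proof (induction rule: free_space_induct)
    case (basis p)
    then show ?case by (intro bexI[of _ "basis_vec (fst p)"]) (auto simp: free_space_def)
  next
    case (add K1 K2)
    then obtain x y where xy: "x \<in> free_space I" "K1 = tensor x (basis_vec e)"
      "y \<in> free_space I" "K2 = tensor y (basis_vec e)" by blast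
    then have "x + y \<in> free_space I" by (metis free_vs.subspace_add subspace_free_space)
    with xy show ?case by (intro bexI[of _ "x + y"]) (simp_all add: tensor_def lin_ext_add)
  next
    case (scale c K)
    then obtain x where x: "x \<in> free_space I" "K = tensor x (basis_vec e)" by blast
    then have "scale c x \<in> free_space I" by (metis free_vs.subspace_scale subspace_free_space)
    with x show ?case by (intro bexI[of _ "scale c x"]) (simp_all add: tensor_def lin_ext_scale)
  next
    case zero
    show ?case by (intro bexI[of _ 0]) (simp_all add: free_space_def tensor_def lin_ext_def)
  qed
  then show ?thesis using that by blast
qed

section \<open>The central involution \<open>S\<close> in the triple tensor power\<close>

locale central_involution = group G for G (structure) +
  fixes u :: 'g and H :: "('g, 'k::field_char_0) based_hopf"
    and R :: "'g \<times> 'g \<Rightarrow>\<^sub>0 'k" and S :: "'g \<times> 'g \<times> 'g \<Rightarrow>\<^sub>0 'k"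
  assumes central: "u \<in> group_center G" and square: "u \<otimes> u = \<one>"
  defines "H \<equiv> group_hopf G" and "R \<equiv> group_R G u" and "S \<equiv> leg21 H R"
begin

lemma u_closed [simp]: "u \<in> carrier G"
  using central by (auto simp: group_center_def centralizer_def)

lemma u_comm: "a \<in> carrier G \<Longrightarrow> u \<otimes> a = a \<otimes> u"
  using central by (auto simp: group_center_def centralizer_def)

lemma u_cancel: "a \<in> carrier G \<Longrightarrow> u \<otimes> (u \<otimes> a) = a"
  using m_assoc[of u u a] by (simp add: square)

abbreviation m3 where "m3 \<equiv> alg_mult (tensor3 H)"

lemma alg_space_tensor3: "alg_space (tensor3 H) = free_space (carrier G \<times> carrier G \<times> carrier G)"
  by (simp add: alg_space_def tensor_algebra_def H_def group_hopf_def)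

lemma m3_basis_vec:
  "m3 (basis_vec (a, b, c)) (basis_vec (a', b', c')) = basis_vec (a \<otimes> a', b \<otimes> b', c \<otimes> c')"
  by (simp add: alg_mult_def tensor_algebra_def H_def group_hopf_def)

lemma m3_linear:
  "m3 (x + y) z = m3 x z + m3 y z" "m3 (x - y) z = m3 x z - m3 y z"
  "m3 (scale c x) z = scale c (m3 x z)"
  "m3 z (x + y) = m3 z x + m3 z y" "m3 z (x - y) = m3 z x - m3 z y"
  "m3 z (scale c x) = scale c (m3 z x)"
  "m3 0 z = 0" "m3 z 0 = 0"
  by (simp_all add: alg_mult_def lin_ext_add lin_ext_diff lin_ext_scale
      lin_ext_add_fun lin_ext_diff_fun lin_ext_scale_fun)

lemma m3_closed:
  assumes x: "x \<in> alg_space (tensor3 H)" and y: "y \<in> alg_space (tensor3 H)"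
  shows "m3 x y \<in> alg_space (tensor3 H)"
  using x unfolding alg_space_tensor3
proof (induction rule: free_space_induct)
  case (basis p)
  from y show ?case
    unfolding alg_space_tensor3
  proof (induction rule: free_space_induct)
    case (basis q)
    with \<open>p \<in> _\<close> show ?case
      by (cases p; cases q) (simp add: m3_basis_vec free_space_def)
  qed (simp_all add: m3_linear subspace_free_space free_vs.subspace_add free_vs.subspace_scale
      free_vs.subspace_0)
qed (simp_all add: m3_linear subspace_free_space free_vs.subspace_add free_vs.subspace_scale
      free_vs.subspace_0)

lemma m3_assoc:
  assumes x: "x \<in> alg_space (tensor3 H)" and y: "y \<in> alg_space (tensor3 H)"
    and z: "z \<in> alg_space (tensor3 H)"
  shows "m3 (m3 x y) z = m3 x (m3 y z)"
  using x unfolding alg_space_tensor3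
proof (induction rule: free_space_induct)
  case p: (basis p)
  from y show ?case
    unfolding alg_space_tensor3
  proof (induction rule: free_space_induct)
    case q: (basis q)
    from z show ?case
      unfolding alg_space_tensor3
    proof (induction rule: free_space_induct)
      case (basis r)
      with p q show ?case
        by (cases p; cases q; cases r) (simp add: m3_basis_vec m_assoc)
    qed (simp_all add: m3_linear)
  qed (simp_all add: m3_linear)
qed (simp_all add: m3_linear)

lemma S_expand:
  "S = scale (1 / 2) (basis_vec (\<one>, \<one>, \<one>) + basis_vec (\<one>, u, \<one>)
     + basis_vec (u, \<one>, \<one>) - basis_vec (u, u, \<one>))"
  by (rule poly_mapping_eqI)
    (simp add: S_def R_def group_R_expand lin_simps H_def group_hopf_def lookup_add lookup_minus)

text \<open>The flip exchanges the two mixed terms of \<open>R\<close> and fixes the other two, so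
  \<open>R\<close> is symmetric.\<close>

lemma leg12_R: "leg12 H R = S"
  by (rule poly_mapping_eqI)
    (simp add: S_expand R_def group_R_expand lin_simps H_def group_hopf_def lookup_add lookup_minus)

text \<open>With the two legs of \<open>u\<close> acting by signs, \<open>S\<close> acts by -1 if
  both signs are -1 and by 1 otherwise, so it squares to 1. Stating this as an action on
  \<open>x\<close> lets one induction on \<open>x\<close> prove it directly.\<close>

lemma S_involution:
  assumes "x \<in> alg_space (tensor3 H)"
  shows "m3 S (m3 S x) = x"
  using assms unfolding alg_space_tensor3
proof (induction rule: free_space_induct)
  case (basis p)
  then show ?case
    by (cases p, intro poly_mapping_eqI)
      (simp add: S_expand m3_linear m3_basis_vec u_cancel lookup_add lookup_minus field_simps)
qed (simp_all add: m3_linear)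

text \<open>Every leg of \<open>S\<close> is a combination of \<one> and the central element
  \<open>u\<close>.\<close>

lemma S_central:
  assumes "x \<in> alg_space (tensor3 H)"
  shows "m3 x S = m3 S x"
  using assms unfolding alg_space_tensor3
proof (induction rule: free_space_induct)
  case (basis p)
  then show ?case
    by (cases p) (simp add: S_expand m3_linear m3_basis_vec u_comm)
qed (simp_all add: m3_linear)

lemma alg_one_tensor3: "alg_one (tensor3 H) = basis_vec (\<one>, \<one>, \<one>)"
  by (simp add: tensor_algebra_def H_def group_hopf_def)

lemma m3_one:
  "x \<in> alg_space (tensor3 H) \<Longrightarrow> m3 x (alg_one (tensor3 H)) = x"
  unfolding alg_space_tensor3
proof (induction rule: free_space_induct)
  case (basis p)
  then show ?case
    by (cases p) (simp add: alg_one_tensor3 m3_basis_vec)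
qed (simp_all add: m3_linear)

lemma S_closed: "S \<in> alg_space (tensor3 H)"
  by (auto simp: alg_space_tensor3 S_expand free_space_def in_keys_iff lookup_add lookup_minus
      lookup_single when_def split: if_splits)

lemma alg_inv_S: "alg_inv (tensor3 H) S = S"
  unfolding alg_inv_def
proof (rule the_equality)
  have one: "alg_one (tensor3 H) \<in> alg_space (tensor3 H)"
    by (simp add: alg_space_tensor3 alg_one_tensor3 free_space_def)
  have "m3 S S = alg_one (tensor3 H)"
    using S_involution[OF one] m3_one[OF S_closed] by simp
  then show "S \<in> alg_space (tensor3 H) \<and> alg_inverse_of (tensor3 H) S S"
    using S_closed by (simp add: alg_inverse_of_def)
  \<comment> \<open>Uniqueness: applying \<open>S\<close> to \<open>S y = 1\<close> gives
    \<open>y = S\<close>.\<close>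
  show "y = S" if "y \<in> alg_space (tensor3 H) \<and> alg_inverse_of (tensor3 H) S y" for y
    using that S_involution[of y] m3_one[OF S_closed] by (simp add: alg_inverse_of_def)
qed

section \<open>Removing the R-matrix from the K-matrix equations\<close>

lemma leg_linear:
  "leg13 H (x + y) = leg13 H x + leg13 H y" "leg13 H (scale c x) = scale c (leg13 H x)" "leg13 H 0 = 0"
  "leg23 H (x + y) = leg23 H x + leg23 H y" "leg23 H (scale c x) = scale c (leg23 H x)" "leg23 H 0 = 0"
  by (simp_all add: leg13_def leg23_def tensor_def lin_ext_add lin_ext_scale
      lin_ext_add_fun lin_ext_scale_fun)

lemma leg_basis_vec:
  "leg13 H (basis_vec (a, b)) = basis_vec (a, \<one>, b)"
  "leg23 H (basis_vec (a, b)) = basis_vec (\<one>, a, b)"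
  by (simp_all add: leg13_def leg23_def H_def group_hopf_def)

lemma leg_closed:
  assumes "K \<in> free_space (carrier G \<times> carrier G)"
  shows "leg13 H K \<in> alg_space (tensor3 H)" "leg23 H K \<in> alg_space (tensor3 H)"
proof -
  have "leg13 H K \<in> alg_space (tensor3 H) \<and> leg23 H K \<in> alg_space (tensor3 H)"
    using assms unfolding alg_space_tensor3
  proof (induction rule: free_space_induct)
    case (basis p)
    then show ?case by (cases p) (simp add: leg_basis_vec free_space_def)
  qed (simp_all add: leg_linear subspace_free_space free_vs.subspace_add free_vs.subspace_scale
      free_vs.subspace_0)
  then show "leg13 H K \<in> alg_space (tensor3 H)" "leg23 H K \<in> alg_space (tensor3 H)" by auto
qed

text \<open>Simplifies the right side of the equation for \<open>id_comult\<close>, where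
  \<open>x\<close> is \<open>leg13 H K\<close>.\<close>

lemma S_conjugation:
  assumes "x \<in> alg_space (tensor3 H)"
  shows "m3 (m3 S x) S = x"
  using assms by (simp add: S_central S_closed m3_closed S_involution)

lemma S_cancel:
  assumes "x \<in> alg_space (tensor3 H)" "y \<in> alg_space (tensor3 H)"
  shows "m3 (m3 (m3 x S) y) S = m3 x y"
proof -
  \<comment> \<open>Centrality carries the inner \<open>S\<close> to the far left, which leaves a
    conjugation by \<open>S\<close>.\<close>
  have "m3 (m3 (m3 x S) y) S = m3 (m3 S (m3 x y)) S"
    using assms by (simp add: S_central m3_assoc S_closed)
  also have "\<dots> = m3 x y"
    using assms by (intro S_conjugation m3_closed)
  finally show ?thesis .
qed

text \<open>\<open>S\<close> is its own inverse and equals both \<open>leg12 H R\<close> and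
  \<open>leg21 H R\<close>, so the two cancellation lemmas remove it. Both inclusions start from
  this form.\<close>

lemma K_matrix_iff:
  assumes "subgroup L G"
  shows "K_matrix H R (free_space L) K \<longleftrightarrow>
     K \<in> tensor_space (free_space (carrier G)) (free_space L) \<and>
     (\<exists>K' \<in> tensor_space (free_space (carrier G)) (free_space L). alg_inverse_of (tensor2 H) K K') \<and>
     comult_id H K = m3 (leg23 H K) (leg13 H K) \<and> id_comult H K = leg13 H K \<and>
     (\<forall>b \<in> free_space L. alg_mult (tensor2 H) K (comult H b) = alg_mult (tensor2 H) (comult H b) K)"
proof -
  have H: "alg_space H = free_space (carrier G)"
    by (simp add: alg_space_def H_def group_hopf_def)
  \<comment> \<open>Puts the legs of \<open>K\<close> into the triple tensor power, where the
    cancellation lemmas apply.\<close>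
  have "K \<in> free_space (carrier G \<times> carrier G)"
    if "K \<in> tensor_space (free_space (carrier G)) (free_space L)"
    using that tensor_space_subset_free_space[of "carrier G" L] subgroup.subset[OF assms]
    by (force simp: free_space_def)
  then show ?thesis
    by (auto simp: K_matrix_def H Let_def S_conjugation S_cancel leg_closed leg12_R alg_inv_S
        simp flip: S_def)
qed

section \<open>Coefficients of the reduced equations and group-like elements\<close>

lemma lookup_id_comult:
  "Poly_Mapping.lookup (id_comult H K) (g, h, l) = (Poly_Mapping.lookup K (g, l) when h = l)"
proof -
  have "K \<in> free_space UNIV" by (simp add: free_space_def)
  then show ?thesis
    by (induction rule: free_space_induct)
      (auto simp: id_comult_def tensor_map_def comult_def lin_ext_add lin_ext_scale H_def
        group_hopf_def lookup_add lookup_single when_def split: if_splits)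
qed

lemma lookup_leg13:
  "Poly_Mapping.lookup (leg13 H K) (g, h, l) = (Poly_Mapping.lookup K (g, l) when h = \<one>)"
proof -
  have "K \<in> free_space UNIV" by (simp add: free_space_def)
  then show ?thesis
    by (induction rule: free_space_induct)
      (auto simp: leg_basis_vec leg_linear lookup_add lookup_single when_def split: if_splits)
qed

lemma lookup_comult_id:
  "Poly_Mapping.lookup (comult_id H K) (g, h, l) = (Poly_Mapping.lookup K (g, l) when g = h)"
proof -
  have "K \<in> free_space UNIV" by (simp add: free_space_def)
  then show ?thesis
    by (induction rule: free_space_induct)
      (auto simp: comult_id_def tensor_map_def tensor_assoc_def comult_def lin_ext_add
        lin_ext_scale H_def group_hopf_def lookup_add lookup_single when_def split: if_splits)
qed

text \<open>The factors \<open>x\<close> and \<open>y\<close> land in different legs and meet only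
  \<one> there. Two separate vectors keep the formula bilinear for the inductions; it is used with
  \<open>y = x\<close>.\<close>

lemma leg23_leg13_tensor:
  assumes x: "x \<in> free_space (carrier G)" and y: "y \<in> free_space (carrier G)"
  shows "m3 (leg23 H (tensor x (basis_vec \<one>))) (leg13 H (tensor y (basis_vec \<one>))) =
    tensor y (tensor x (basis_vec \<one>))"
  using x
proof (induction rule: free_space_induct)
  case (basis a)
  from y show ?case
    by (induction rule: free_space_induct)
      (use basis in \<open>simp_all add: leg_basis_vec m3_basis_vec leg_linear m3_linear
        tensor_def lin_ext_add lin_ext_scale\<close>)
qed (simp_all add: leg_linear m3_linear tensor_def lin_ext_add lin_ext_scale
      lin_ext_add_fun lin_ext_scale_fun)

text \<open>The equation says \<Delta>(x) = \<open>x\<close> tensor \<open>x\<close> in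
  coefficients. At a point \<open>a\<close> of the support, \<open>g = h = a\<close> forces the
  coefficient 1, and \<open>g = a\<close> with \<open>h\<close> different from \<open>a\<close>
  makes the coefficient at \<open>h\<close> vanish.\<close>

lemma grouplike_basis_vec:
  assumes x: "x \<in> free_space (carrier G)" "x \<noteq> 0"
    and eq: "\<And>g h. Poly_Mapping.lookup x g * Poly_Mapping.lookup x h = (Poly_Mapping.lookup x g when g = h)"
  obtains a where "a \<in> carrier G" "x = basis_vec a"
proof -
  from x obtain a where a: "a \<in> Poly_Mapping.keys x" by fastforce
  then have "a \<in> carrier G" using x by (auto simp: free_space_def)
  moreover have "x = basis_vec a"
  proof (rule poly_mapping_eqI)
    fix h
    show "Poly_Mapping.lookup x h = Poly_Mapping.lookup (basis_vec a) h"
      using eq[of a h] a by (cases "h = a") (auto simp: in_keys_iff lookup_single)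
  qed
  ultimately show ?thesis using that by blast
qed

lemma mult_tensor2_basis_vec:
  "alg_mult (tensor2 H) (basis_vec (a, b)) (basis_vec (c, d)) = basis_vec (a \<otimes> c, b \<otimes> d)"
  by (simp add: alg_mult_def tensor_algebra_def H_def group_hopf_def)

section \<open>The two inclusions\<close>

lemma K_matrix_imp_centralizer:
  assumes L: "subgroup L G" and K: "K_matrix H R (free_space L) K"
  obtains a where "a \<in> centralizer G L" "K = tensor (basis_vec a) (basis_vec \<one>)"
proof -
  note K = K[unfolded K_matrix_iff[OF L]]
  have "K \<in> free_space (carrier G \<times> L)"
    using K tensor_space_subset_free_space by blast
  \<comment> \<open>Compare coefficients at \<open>(g, l, l)\<close>: \<open>id_comult H K\<close>
    has that of \<open>K\<close> at \<open>(g, l)\<close>, while \<open>leg13 H K\<close> has 0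
    unless \<open>l = \<one>\<close>.\<close>
  moreover have "l = \<one>" if "(g, l) \<in> Poly_Mapping.keys K" for g l
    using K that lookup_id_comult[of K g l l] lookup_leg13[of K g l l]
    by (auto simp: in_keys_iff when_def split: if_splits)
  ultimately have "K \<in> free_space (carrier G \<times> {\<one>})"
    by (auto simp: free_space_def)
  then obtain x where x: "x \<in> free_space (carrier G)" "K = tensor x (basis_vec \<one>)"
    by (rule free_space_Times_singleton)
  \<comment> \<open>Invertibility enters here: \<open>K = 0\<close> satisfies both reduced coproduct
    equations.\<close>
  have "x \<noteq> 0"
  proof
    assume "x = 0"
    then have "K = 0" by (simp add: x tensor_def)
    then have "alg_one (tensor2 H) = 0" using K by (auto simp: alg_inverse_of_def alg_mult_def)
    then have "basis_vec (\<one>, \<one>) = (0 :: _ \<Rightarrow>\<^sub>0 'k)"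
      by (simp add: tensor_algebra_def H_def group_hopf_def)
    from arg_cong[OF this, of Poly_Mapping.keys] show False by simp
  qed
  \<comment> \<open>These are the coefficients of the first reduced equation at
    \<open>(g, h, \<one>)\<close>.\<close>
  moreover have "Poly_Mapping.lookup x g * Poly_Mapping.lookup x h = (Poly_Mapping.lookup x g when g = h)" for g h
    using lookup_comult_id[of K g h \<one>] K
    by (simp add: x leg23_leg13_tensor lookup_tensor)
  ultimately obtain a where a: "a \<in> carrier G" "x = basis_vec a"
    using x(1) grouplike_basis_vec by blast
  have "a \<otimes> l = l \<otimes> a" if "l \<in> L" for l
  proof -
    have "basis_vec l \<in> (free_space L :: ('g \<Rightarrow>\<^sub>0 'k) set)" using that by (simp add: free_space_def)
    then have "alg_mult (tensor2 H) K (comult H (basis_vec l)) = alg_mult (tensor2 H) (comult H (basis_vec l)) K"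
      using K by blast
    moreover have "comult H (basis_vec l) = basis_vec (l, l)"
      by (simp add: comult_def H_def group_hopf_def)
    ultimately have "basis_vec (a \<otimes> l, \<one> \<otimes> l) = (basis_vec (l \<otimes> a, l \<otimes> \<one>) :: _ \<Rightarrow>\<^sub>0 'k)"
      by (simp add: x a mult_tensor2_basis_vec)
    \<comment> \<open>A basis vector is recovered from its support; the first components give the
      commutation.\<close>
    from arg_cong[OF this, of Poly_Mapping.keys] show ?thesis by simp
  qed
  then show ?thesis using that a x by (auto simp: centralizer_def)
qed

lemma centralizer_imp_K_matrix:
  assumes L: "subgroup L G" and a: "a \<in> centralizer G L"
  shows "K_matrix H R (free_space L) (tensor (basis_vec a) (basis_vec \<one>))"
  unfolding K_matrix_iff[OF L]
proof (intro conjI ballI)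
  have aG: "a \<in> carrier G" and comm: "\<And>l. l \<in> L \<Longrightarrow> a \<otimes> l = l \<otimes> a"
    using a by (auto simp: centralizer_def)
  have closed: "tensor (basis_vec b) (basis_vec \<one>) \<in>
      tensor_space (free_space (carrier G)) (free_space L :: ('g \<Rightarrow>\<^sub>0 'k) set)" if "b \<in> carrier G" for b
    unfolding tensor_space_def
    by (intro free_vs.span_base CollectI exI[of _ "basis_vec b"] exI[of _ "basis_vec \<one>"])
      (use that subgroup.one_closed[OF L] in \<open>simp add: free_space_def\<close>)
  then show "tensor (basis_vec a) (basis_vec \<one>) \<in>
      tensor_space (free_space (carrier G)) (free_space L :: ('g \<Rightarrow>\<^sub>0 'k) set)"
    using aG .
  show "\<exists>K'\<in>tensor_space (free_space (carrier G)) (free_space L).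
      alg_inverse_of (tensor2 H) (tensor (basis_vec a) (basis_vec \<one>)) K'"
    \<comment> \<open>The inverse is \<open>inv a\<close> tensor \<one>, which again has its second
      leg in the group algebra of \<open>L\<close>.\<close>
    using aG by (intro bexI[OF _ closed[of "inv a"]])
      (simp_all add: alg_inverse_of_def mult_tensor2_basis_vec tensor_algebra_def,
        simp add: H_def group_hopf_def alg_mult_def)
  show "comult_id H (tensor (basis_vec a) (basis_vec \<one>)) =
      m3 (leg23 H (tensor (basis_vec a) (basis_vec \<one>))) (leg13 H (tensor (basis_vec a) (basis_vec \<one>)))"
    using aG by (simp add: leg_basis_vec m3_basis_vec)
      (simp add: comult_id_def tensor_map_def tensor_assoc_def comult_def H_def group_hopf_def)
  show "id_comult H (tensor (basis_vec a) (basis_vec \<one>)) = leg13 H (tensor (basis_vec a) (basis_vec \<one>))"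
    by (simp add: leg_basis_vec)
      (simp add: id_comult_def tensor_map_def comult_def H_def group_hopf_def)
  fix b :: "'g \<Rightarrow>\<^sub>0 'k" assume "b \<in> free_space L"
  then show "alg_mult (tensor2 H) (tensor (basis_vec a) (basis_vec \<one>)) (comult H b) =
      alg_mult (tensor2 H) (comult H b) (tensor (basis_vec a) (basis_vec \<one>))"
  \<comment> \<open>Both sides are linear in \<open>b\<close>; for \<open>b = l\<close> the first
    legs agree by \<open>comm\<close> and the second legs are both \<open>l\<close>.\<close>
  proof (induction rule: free_space_induct)
    case (basis l)
    then show ?case
      using comm[of l] subgroup.mem_carrier[OF L]
      by (simp add: comult_def alg_mult_def tensor_algebra_def H_def group_hopf_def)
  qed (simp_all add: comult_def alg_mult_def lin_ext_add lin_ext_scale lin_ext_add_fun lin_ext_scale_fun)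
qed

end

theorem proposition4p3:
  fixes G (structure) and u :: 'g and L :: "'g set"
  assumes "group G" and "finite (carrier G)"
    and "u \<in> group_center G" and "u \<otimes> u = \<one>"
    and "subgroup L G"
  shows "{K :: 'g \<times> 'g \<Rightarrow>\<^sub>0 'k::{alg_closed_field, field_char_0}.
            K_matrix (group_hopf G) (group_R G u) (free_space L) K}
         = {tensor (basis_vec a) (basis_vec \<one>) | a. a \<in> centralizer G L}"
proof -
  \<comment> \<open>\<open>H\<close>, \<open>R\<close> and \<open>S\<close> are instantiated with
    their defining terms, so the locale lemmas speak directly about the concrete data.\<close>
  interpret central_involution G u "group_hopf G :: ('g, 'k) based_hopf" "group_R G u"
    "leg21 (group_hopf G) (group_R G u)"
    using assms by (simp add: central_involution_def central_involution_axioms_def)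
  show ?thesis
    using K_matrix_imp_centralizer[OF assms(5)] centralizer_imp_K_matrix[OF assms(5)] by blast
qed

end
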